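(* There exists a constant $c>0$ such that any algorithm in the weak-strong oracle model with corruption probability $\delta=1/3$ (where the weak oracle distances $\tilde d$ need not form a metric) which outputs a spanning tree $T$ of an $n$-point metric space $(\mathcal{X},d)$ such that $\mathbb{E}[w(T)]\le c\log n\cdot\min_{T'}w(T')$ must make at least $\Omega(n)$ strong oracle (point) queries.
   Context: Weak-strong oracle model: unknown metric $d$ on $n$ points; independently for each unordered pair, with probability $\delta$ the pair is corrupted (randomness drawn once); the weak oracle returns $\tilde d(x,y)=d(x,y)$ for uncorrupted pairs and an arbitrary value chosen by an adversary (knowing $d$ and the corrupted set) for corrupted pairs. A strong point query on $x$ returns a symbol from which, together with that of $y$, $d(x,y)$ can be computed. For a spanning tree $T$, $w(T)=\sum_{(x,y)\in T}d(x,y)$; the minimum is over all spanning trees $T'$. *)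

theory Defs
  imports "HOL-Probability.Probability" "HOL-Analysis.Abstract_Metric_Spaces"
begin

text \<open>The points are \<open>{..<n}\<close>. Unordered pairs are two-element sets, and a graph on the points is
  a set of such pairs.\<close>

definition point_pairs :: "nat \<Rightarrow> nat set set" where
  "point_pairs n = {e. e \<subseteq> {..<n} \<and> card e = 2}"

definition graph_connected :: "nat \<Rightarrow> nat set set \<Rightarrow> bool" where
  "graph_connected n T \<longleftrightarrow> (\<forall>x<n. \<forall>y<n. (x, y) \<in> {(u, v). {u, v} \<in> T}\<^sup>*)"

definition graph_cycle :: "nat set set \<Rightarrow> nat list \<Rightarrow> bool" where
  "graph_cycle T xs \<longleftrightarrow> 3 \<le> length xs \<and> distinct xs \<and>
     (\<forall>i<length xs. {xs ! i, xs ! (Suc i mod length xs)} \<in> T)"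

definition spanning_tree :: "nat \<Rightarrow> nat set set \<Rightarrow> bool" where
  "spanning_tree n T \<longleftrightarrow> T \<subseteq> point_pairs n \<and> graph_connected n T \<and> (\<nexists>xs. graph_cycle T xs)"

text \<open>Each edge is counted once, through its orientation \<open>x < y\<close>.\<close>

definition tree_weight :: "(nat \<Rightarrow> nat \<Rightarrow> real) \<Rightarrow> nat set set \<Rightarrow> real" where
  "tree_weight d T = (\<Sum>(x, y) \<in> {(x, y). x < y \<and> {x, y} \<in> T}. d x y)"

definition mst_weight :: "nat \<Rightarrow> (nat \<Rightarrow> nat \<Rightarrow> real) \<Rightarrow> real" where
  "mst_weight n d = Min (tree_weight d ` {T. spanning_tree n T})"

definition corrupted_pairs :: "nat \<Rightarrow> real \<Rightarrow> nat set set pmf" where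
  "corrupted_pairs n \<delta> =
     map_pmf (\<lambda>f. {e \<in> point_pairs n. f e}) (Pi_pmf (point_pairs n) False (\<lambda>_. bernoulli_pmf \<delta>))"

text \<open>An adversary for a given metric maps the corrupted set to the values shown on the corrupted
  pairs; these values are unconstrained, so the weak distances need not form a metric.\<close>

type_synonym adversary = "nat set set \<Rightarrow> nat set \<Rightarrow> real"

definition weak_oracle ::
    "(nat \<Rightarrow> nat \<Rightarrow> real) \<Rightarrow> adversary \<Rightarrow> nat set set \<Rightarrow> nat \<Rightarrow> nat \<Rightarrow> real" where
  "weak_oracle d adv C x y = (if {x, y} \<in> C then adv C {x, y} else d x y)"

text \<open>The strong oracle answers a query on \<open>x\<close> with a symbol \<open>\<sigma> x\<close>, and \<open>dec\<close> computes a distance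
  from two symbols. Symbols are finite strings, coded as natural numbers.\<close>

definition weak_strong_instance ::
    "nat \<Rightarrow> (nat \<Rightarrow> nat \<Rightarrow> real) \<Rightarrow> (nat \<Rightarrow> nat) \<Rightarrow> (nat \<Rightarrow> nat \<Rightarrow> real) \<Rightarrow> bool" where
  "weak_strong_instance n d \<sigma> dec \<longleftrightarrow>
     Metric_space {..<n} d \<and> (\<forall>x<n. \<forall>y<n. dec (\<sigma> x) (\<sigma> y) = d x y)"

text \<open>An adaptive randomized procedure: output an edge set, or continue after a weak query, after a
  strong query, or after a random choice.\<close>

datatype strategy =
    Output "nat set set"
  | Weak nat nat "real \<Rightarrow> strategy"
  | Strong nat "nat \<Rightarrow> strategy"
  | Random "strategy pmf"

text \<open>Joint law of the output and the number of strong queries made, for fixed oracles.\<close>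

primrec run ::
    "(nat \<Rightarrow> nat \<Rightarrow> real) \<Rightarrow> (nat \<Rightarrow> nat) \<Rightarrow> strategy \<Rightarrow> (nat set set \<times> nat) pmf" where
  "run w \<sigma> (Output T) = return_pmf (T, 0)"
| "run w \<sigma> (Weak x y k) = run w \<sigma> (k (w x y))"
| "run w \<sigma> (Strong x k) = map_pmf (\<lambda>(T, q). (T, Suc q)) (run w \<sigma> (k (\<sigma> x)))"
| "run w \<sigma> (Random p) = join_pmf (map_pmf (run w \<sigma>) p)"

text \<open>The corrupted set is drawn once, before the interaction.\<close>

definition execution ::
    "nat \<Rightarrow> real \<Rightarrow> (nat \<Rightarrow> nat \<Rightarrow> real) \<Rightarrow> adversary \<Rightarrow> (nat \<Rightarrow> nat) \<Rightarrow> strategy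
      \<Rightarrow> (nat set set \<times> nat) pmf" where
  "execution n \<delta> d adv \<sigma> s =
     bind_pmf (corrupted_pairs n \<delta>) (\<lambda>C. run (weak_oracle d adv C) \<sigma> s)"

text \<open>An algorithm for \<open>n\<close> points may use \<open>dec\<close>, hence is a map from decoders to strategies. It has to
  be correct for every encoding of every metric: for one fixed encoding the symbol of a single point
  might already reveal the whole metric.\<close>

type_synonym algorithm = "(nat \<Rightarrow> nat \<Rightarrow> real) \<Rightarrow> strategy"

definition outputs_spanning_tree :: "nat \<Rightarrow> real \<Rightarrow> algorithm \<Rightarrow> bool" where
  "outputs_spanning_tree n \<delta> A \<longleftrightarrow>
     (\<forall>d \<sigma> dec adv. weak_strong_instance n d \<sigma> dec \<longrightarrow>
        (\<forall>(T, q) \<in> set_pmf (execution n \<delta> d adv \<sigma> (A dec)). spanning_tree n T))"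

definition expected_mst_approx :: "nat \<Rightarrow> real \<Rightarrow> real \<Rightarrow> algorithm \<Rightarrow> bool" where
  "expected_mst_approx n \<delta> \<alpha> A \<longleftrightarrow>
     (\<forall>d \<sigma> dec adv. weak_strong_instance n d \<sigma> dec \<longrightarrow>
        measure_pmf.expectation (execution n \<delta> d adv \<sigma> (A dec)) (\<lambda>(T, q). tree_weight d T)
          \<le> \<alpha> * mst_weight n d)"

definition strong_queries_at_most :: "nat \<Rightarrow> real \<Rightarrow> nat \<Rightarrow> algorithm \<Rightarrow> bool" where
  "strong_queries_at_most n \<delta> m A \<longleftrightarrow>
     (\<forall>d \<sigma> dec adv. weak_strong_instance n d \<sigma> dec \<longrightarrow>
        (\<forall>(T, q) \<in> set_pmf (execution n \<delta> d adv \<sigma> (A dec)). q \<le> m))"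

end

theory Submission
  imports Defs "HOL-Real_Asymp.Real_Asymp"
begin

text \<open>Put the points independently and uniformly into \<open>N \<approx> 8 n / ln n\<close> clusters, with distance \<open>1\<close>
  inside a cluster and \<open>D = n\<close> between clusters; then a minimum spanning tree weighs at most
  \<open>n + D N = O(D n / ln n)\<close>. The adversary exchanges \<open>1\<close> and \<open>D\<close> on every corrupted pair, so the weak
  answers are independent bits with error rate \<open>1/3\<close>. Moving one point \<open>x\<close> out of a cluster of size at
  most \<open>K = (ln n) / 2\<close> changes the likelihood of these bits by a factor of at most \<open>2 ^ K = o(N)\<close>, and
  most clusters are that small. Hence, unless \<open>x\<close> itself is strongly queried, every point
  that the algorithm attaches \<open>x\<close> to lies in the cluster of \<open>x\<close> only with small probability. Since a
  spanning tree assigns to the points other than the root pairwise distinct parent edges, it has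
  \<open>\<Omega>(n)\<close> edges of length \<open>D\<close> in expectation if few points are strongly queried.\<close>

section \<open>Spanning trees: parent edges and weight bounds\<close>

lemma finite_point_pairs [simp]: "finite (point_pairs n)"
  by (rule finite_subset[of _ "Pow {..<n}"]) (auto simp: point_pairs_def)

lemma pair_in_point_pairs_iff [simp]: "{x, y} \<in> point_pairs n \<longleftrightarrow> x < n \<and> y < n \<and> x \<noteq> y"
  by (auto simp: point_pairs_def card_insert_if)

lemma point_pairs_cases:
  assumes "e \<in> point_pairs n"
  obtains x y where "e = {x, y}" "x < n" "y < n" "x \<noteq> y"
  using assms by (auto simp: point_pairs_def card_2_iff)

text \<open>Root the graph at \<open>0\<close> and let \<open>p x\<close> be a neighbour strictly
  closer to the root. Two points sharing a parent edge would each be closer than the other.\<close>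

lemma connected_parent:
  assumes conn: "graph_connected n T" and n: "n > 0"
  shows "\<exists>p. (\<forall>x\<in>{0<..<n}. {x, p x} \<in> T) \<and> inj_on (\<lambda>x. {x, p x}) {0<..<n}"
proof -
  define R where "R = {(u, v). {u, v} \<in> T}"
  define dist where "dist x = (LEAST k. (x, 0) \<in> R ^^ k)" for x :: nat
  have dist: "(x, 0) \<in> R ^^ dist x" if "x < n" for x
  proof -
    have "(x, 0) \<in> R\<^sup>*" using conn n that by (auto simp: graph_connected_def R_def)
    then obtain k where "(x, 0) \<in> R ^^ k" by (auto simp: rtrancl_power)
    then show ?thesis unfolding dist_def by (rule LeastI)
  qed
  have "\<exists>y. {x, y} \<in> T \<and> dist y < dist x" if "x \<in> {0<..<n}" for x
  proof (cases "dist x")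
    case 0
    with dist[of x] that show ?thesis by auto
  next
    case (Suc j)
    with dist[of x] that have "(x, 0) \<in> R ^^ Suc j" by simp
    then obtain y where "(x, y) \<in> R" "(y, 0) \<in> R ^^ j" by (rule relpow_Suc_E2)
    moreover from this have "dist y \<le> j" unfolding dist_def by (intro Least_le)
    ultimately show ?thesis using Suc by (auto simp: R_def)
  qed
  then obtain p where p: "\<And>x. x \<in> {0<..<n} \<Longrightarrow> {x, p x} \<in> T \<and> dist (p x) < dist x"
    by metis
  have "inj_on (\<lambda>x. {x, p x}) {0<..<n}"
  proof (rule inj_onI)
    fix x y assume xy: "x \<in> {0<..<n}" "y \<in> {0<..<n}" "{x, p x} = {y, p y}"
    show "x = y"
    proof (rule ccontr)
      assume "x \<noteq> y"
      with xy(3) have "p x = y" "p y = x" by (auto simp: doubleton_eq_iff)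
      with p[OF xy(1)] p[OF xy(2)] show False by simp
    qed
  qed
  with p show ?thesis by blast
qed

text \<open>Each point of \<open>S\<close> is charged its own edge: injectivity keeps these edges
  distinct, and all other edges have nonnegative length.\<close>

lemma tree_weight_ge:
  assumes T: "T \<subseteq> point_pairs n" and D: "D \<ge> 0"
    and nonneg: "\<And>x y. d x y \<ge> 0" and sym: "\<And>x y. d x y = d y x"
    and S: "finite S" "inj_on (\<lambda>x. {x, p x}) S" "\<And>x. x \<in> S \<Longrightarrow> {x, p x} \<in> T"
    and far: "\<And>x. x \<in> S \<Longrightarrow> d x (p x) \<ge> D"
  shows "D * real (card S) \<le> tree_weight d T"
proof -
  \<comment> \<open>\<open>h\<close> gives the parent edge the orientation under which
    \<open>tree_weight\<close> counts it.\<close>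
  define h where "h x = (min x (p x), max x (p x))" for x
  have mm: "{min x (p x), max x (p x)} = {x, p x}" for x
    by (auto simp: min_def max_def)
  have inj: "inj_on h S"
  proof (rule inj_onI)
    fix x y assume "x \<in> S" "y \<in> S" "h x = h y"
    then show "x = y" using S(2) mm[of x] mm[of y]
      unfolding inj_on_def h_def by (metis prod.inject)
  qed
  have fin: "finite {(x, y). x < y \<and> {x, y} \<in> T}"
    by (rule finite_subset[of _ "{..<n} \<times> {..<n}"]) (use T in auto)
  have sub: "h ` S \<subseteq> {(x, y). x < y \<and> {x, y} \<in> T}"
  proof
    fix z assume "z \<in> h ` S"
    then obtain x where x: "x \<in> S" "z = h x" by auto
    have "x \<noteq> p x" using S(3)[OF x(1)] T by (metis pair_in_point_pairs_iff subsetD)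
    then show "z \<in> {(x, y). x < y \<and> {x, y} \<in> T}"
      using S(3)[OF x(1)] mm[of x] by (auto simp: x(2) h_def min_def max_def)
  qed
  have "D * real (card S) = (\<Sum>x\<in>S. D)" by simp
  also have "\<dots> \<le> (\<Sum>x\<in>S. d (fst (h x)) (snd (h x)))"
    using far sym by (intro sum_mono) (auto simp: h_def min_def max_def)
  also have "\<dots> = (\<Sum>(x, y)\<in>h ` S. d x y)"
    using inj by (simp add: sum.reindex case_prod_beta)
  also have "\<dots> \<le> tree_weight d T"
    unfolding tree_weight_def using nonneg by (intro sum_mono2 fin sub) auto
  finally show ?thesis .
qed

text \<open>The largest vertex of a cycle would have two smaller neighbours.\<close>

lemma spanning_tree_parent:
  assumes f: "\<And>x. x \<in> {0<..<n} \<Longrightarrow> f x < x"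
  shows "spanning_tree n ((\<lambda>x. {f x, x}) ` {0<..<n})"
proof -
  define T where "T = (\<lambda>x. {f x, x}) ` {0<..<n}"
  define R where "R = {(u, v). {u, v} \<in> T}"
  have sub: "T \<subseteq> point_pairs n"
  proof
    fix e assume "e \<in> T"
    then obtain x where "x \<in> {0<..<n}" "e = {f x, x}" by (auto simp: T_def)
    with f[of x] show "e \<in> point_pairs n" by simp
  qed
  have symR: "sym R" by (auto simp: R_def sym_def insert_commute)
  have root: "(x, 0) \<in> R\<^sup>*" if "x < n" for x
    using that
  proof (induction x rule: less_induct)
    case (less x)
    show ?case
    proof (cases "x = 0")
      case False
      with less.prems have "x \<in> {0<..<n}" by simp
      moreover from this have "(x, f x) \<in> R" by (auto simp: R_def T_def insert_commute)
      ultimately show ?thesis using less f[of x] by (meson converse_rtrancl_into_rtrancl less_trans)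
    qed simp
  qed
  have conn: "graph_connected n T"
    unfolding graph_connected_def R_def[symmetric]
    using root symR by (meson rtrancl_trans symD sym_rtrancl)
  have edge: "u = f v" if "{u, v} \<in> T" "u < v" for u v
    using that f by (fastforce simp: T_def doubleton_eq_iff)
  have "\<not> graph_cycle T xs" for xs
  proof
    assume "graph_cycle T xs"
    then have len: "3 \<le> length xs" and dist: "distinct xs"
      and E: "\<And>i. i < length xs \<Longrightarrow> {xs ! i, xs ! (Suc i mod length xs)} \<in> T"
      by (auto simp: graph_cycle_def)
    define l where "l = length xs"
    have "Max (set xs) \<in> set xs" using len by (intro Max_in) auto
    then obtain i where i: "i < l" "xs ! i = Max (set xs)" by (auto simp: in_set_conv_nth l_def)
    \<comment> \<open>\<open>j\<close> and \<open>k\<close> are the cyclic successor and predecessor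
      of \<open>i\<close>; they differ because a cycle has at least three vertices.\<close>
    define j where "j = Suc i mod l"
    define k where "k = (if i = 0 then l - 1 else i - 1)"
    have jk: "j < l" "k < l" "j \<noteq> i" "k \<noteq> i" "j \<noteq> k" "Suc k mod l = i"
      using i len by (auto simp: j_def k_def l_def mod_Suc split: if_splits)
    have lt: "xs ! r < xs ! i" if "r < l" "r \<noteq> i" for r
    proof -
      have "xs ! r \<le> xs ! i" using that by (simp add: i l_def)
      moreover have "xs ! r \<noteq> xs ! i" 
        using nth_eq_iff_index_eq[OF dist, of r i] that i(1) by (simp add: l_def)
      ultimately show ?thesis by simp
    qed
    have "{xs ! j, xs ! i} \<in> T" using E[of i] i by (simp add: j_def l_def insert_commute)
    then have "xs ! j = f (xs ! i)" using edge lt jk by blast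
    moreover have "{xs ! k, xs ! i} \<in> T" using E[of k] jk by (simp add: l_def)
    then have "xs ! k = f (xs ! i)" using edge lt jk by blast
    ultimately show False
      using jk nth_eq_iff_index_eq[OF dist, of j k] by (simp add: l_def)
  qed
  with sub conn show ?thesis by (auto simp: spanning_tree_def T_def)
qed

text \<open>The tree of a parent function is a competitor. Since parents are smaller than their
  children, its oriented edges are exactly the pairs \<open>(f x, x)\<close>, so its weight is a sum
  over the children.\<close>

lemma mst_weight_le_parent:
  assumes f: "\<And>x. x \<in> {0<..<n} \<Longrightarrow> f x < x"
  shows "mst_weight n d \<le> (\<Sum>x\<in>{0<..<n}. d (f x) x)"
proof -
  define T where "T = (\<lambda>x. {f x, x}) ` {0<..<n}"
  have "{(x, y). x < y \<and> {x, y} \<in> T} = (\<lambda>x. (f x, x)) ` {0<..<n}"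
    using f by (fastforce simp: T_def doubleton_eq_iff)
  moreover have "inj_on (\<lambda>x. (f x, x)) {0<..<n}" by (auto simp: inj_on_def)
  ultimately have "tree_weight d T = (\<Sum>x\<in>{0<..<n}. d (f x) x)"
    by (simp add: tree_weight_def sum.reindex)
  moreover have "finite {T. spanning_tree n T}"
    by (rule finite_subset[of _ "Pow (point_pairs n)"]) (auto simp: spanning_tree_def)
  moreover have "spanning_tree n T" unfolding T_def using f by (rule spanning_tree_parent)
  ultimately show ?thesis
    unfolding mst_weight_def by (metis (mono_tags) Min_le finite_imageI imageI mem_Collect_eq)
qed

section \<open>Two-valued cluster metrics and the flipping adversary\<close>

text \<open>One form serves both the true metric and the weak answers, which need not form a metric:
  each is determined by the set \<open>E\<close> of pairs with value \<open>1\<close>. The value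
  \<open>0\<close> elsewhere lets them be compared as total functions.\<close>

definition two_valued :: "nat \<Rightarrow> real \<Rightarrow> nat set set \<Rightarrow> nat \<Rightarrow> nat \<Rightarrow> real" where
  "two_valued n D E x y = (if {x, y} \<notin> point_pairs n then 0 else if {x, y} \<in> E then 1 else D)"

definition cluster_pairs :: "nat \<Rightarrow> (nat \<Rightarrow> nat) \<Rightarrow> nat set set" where
  "cluster_pairs n a = {e \<in> point_pairs n. \<forall>u\<in>e. \<forall>v\<in>e. a u = a v}"

abbreviation cluster_dist :: "nat \<Rightarrow> real \<Rightarrow> (nat \<Rightarrow> nat) \<Rightarrow> nat \<Rightarrow> nat \<Rightarrow> real" where
  "cluster_dist n D a \<equiv> two_valued n D (cluster_pairs n a)"

text \<open>The point is part of the symbol so that the decoder can tell equal points from distinct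
  points of one cluster. The symbol of \<open>x\<close> involves \<open>a\<close> only at
  \<open>x\<close>, and the decoder does not involve \<open>a\<close>.\<close>

definition cluster_symbol :: "(nat \<Rightarrow> nat) \<Rightarrow> nat \<Rightarrow> nat" where
  "cluster_symbol a x = prod_encode (x, a x)"

definition cluster_decode :: "real \<Rightarrow> nat \<Rightarrow> nat \<Rightarrow> real" where
  "cluster_decode D s t = (case (prod_decode s, prod_decode t) of
     ((x, g), (y, h)) \<Rightarrow> if x = y then 0 else if g = h then 1 else D)"

definition flip_adversary :: "nat \<Rightarrow> real \<Rightarrow> (nat \<Rightarrow> nat) \<Rightarrow> adversary" where
  "flip_adversary n D a C e = (if e \<in> cluster_pairs n a then D else 1)"

lemma cluster_dist_eq:
  "cluster_dist n D a x y = (if x = y \<or> x \<ge> n \<or> y \<ge> n then 0 else if a x = a y then 1 else D)"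
  by (auto simp: two_valued_def cluster_pairs_def)

lemma weak_strong_instance_cluster:
  assumes "D \<ge> 1"
  shows "weak_strong_instance n (cluster_dist n D a) (cluster_symbol a) (cluster_decode D)"
  unfolding weak_strong_instance_def
proof
  show "Metric_space {..<n} (cluster_dist n D a)"
    by standard (use assms in \<open>auto simp: cluster_dist_eq\<close>)
qed (auto simp: cluster_dist_eq cluster_symbol_def cluster_decode_def)

text \<open>Exchanging \<open>1\<close> and \<open>D\<close> on a pair toggles its membership in the
  set of pairs with value \<open>1\<close>. The assumption on \<open>C\<close> keeps the adversary
  away from the places where \<open>two_valued\<close> is \<open>0\<close>.\<close>

lemma weak_oracle_flip:
  assumes "C \<subseteq> point_pairs n"
  shows "weak_oracle (cluster_dist n D a) (flip_adversary n D a) C =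
    two_valued n D (sym_diff C (cluster_pairs n a))"
proof (intro ext)
  fix x y
  show "weak_oracle (cluster_dist n D a) (flip_adversary n D a) C x y =
    two_valued n D (sym_diff C (cluster_pairs n a)) x y"
    using subsetD[OF assms, of "{x, y}"]
    by (auto simp: weak_oracle_def flip_adversary_def two_valued_def simp del: insert_iff)
qed

text \<open>Each cluster becomes a star around its least point, and the least points are joined to
  \<open>0\<close>. Only the latter edges, at most one per cluster, can have length
  \<open>D\<close>.\<close>

lemma mst_weight_cluster_le:
  assumes D: "D \<ge> 1" and n: "n > 0" and a: "\<And>x. x < n \<Longrightarrow> a x < N"
  shows "mst_weight n (cluster_dist n D a) \<le> real n + D * real N"
proof -
  define r where "r x = (LEAST y. a y = a x)" for x
  define f where "f x = (if r x = x then 0 else r x)" for x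
  have r: "a (r x) = a x" "r x \<le> x" for x
    unfolding r_def by (rule LeastI Least_le; simp)+
  have f: "f x < x" if "x \<in> {0<..<n}" for x
    using r(2)[of x] that by (auto simp: f_def)
  define S where "S = {x \<in> {0<..<n}. r x = x}"
  have inj: "inj_on a S"
  proof (rule inj_onI)
    fix x y assume "x \<in> S" "y \<in> S" "a x = a y"
    then show "x = y" unfolding S_def r_def by simp
  qed
  have "card S \<le> card {..<N}"
    by (rule card_inj_on_le[OF inj]) (use a in \<open>auto simp: S_def\<close>)
  then have S: "real (card S) \<le> real N" by simp
  have "mst_weight n (cluster_dist n D a) \<le> (\<Sum>x\<in>{0<..<n}. cluster_dist n D a (f x) x)"
    by (rule mst_weight_le_parent) (rule f)
  also have "\<dots> \<le> (\<Sum>x\<in>{0<..<n}. 1 + D * indicator S x)"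
    using D r by (intro sum_mono) (auto simp: cluster_dist_eq f_def S_def indicator_def)
  also have "\<dots> = real (n - 1) + D * real (card S)"
  proof -
    have "(\<Sum>x\<in>{0<..<n}. indicator S x) = real (card ({0<..<n} \<inter> S))"
      by (simp add: indicator_def sum.If_cases)
    also have "{0<..<n} \<inter> S = S" by (auto simp: S_def)
    finally show ?thesis by (simp add: sum.distrib sum_distrib_left[symmetric])
  qed
  also have "\<dots> \<le> real n + D * real N"
    using S D by (intro add_mono mult_left_mono) auto
  finally show ?thesis .
qed

section \<open>Runs with the list of strongly queried points\<close>

text \<open>The number of strong queries is not enough: the argument asks whether one particular
  point was queried.\<close>

primrec trace ::
    "(nat \<Rightarrow> nat \<Rightarrow> real) \<Rightarrow> (nat \<Rightarrow> nat) \<Rightarrow> strategy \<Rightarrow> (nat set set \<times> nat list) pmf" where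
  "trace w \<sigma> (Output T) = return_pmf (T, [])"
| "trace w \<sigma> (Weak x y k) = trace w \<sigma> (k (w x y))"
| "trace w \<sigma> (Strong x k) = map_pmf (\<lambda>(T, xs). (T, x # xs)) (trace w \<sigma> (k (\<sigma> x)))"
| "trace w \<sigma> (Random p) = join_pmf (map_pmf (trace w \<sigma>) p)"

lemma run_eq_trace: "run w \<sigma> s = map_pmf (map_prod id length) (trace w \<sigma> s)"
proof (induction s)
  case (Random p)
  then show ?case
    by (simp add: map_join_pmf map_pmf_comp cong: map_pmf_cong)
qed (simp_all add: map_pmf_comp case_prod_beta)

text \<open>A run that does not query \<open>x\<close> never sees the symbol of \<open>x\<close>,
  and runs that query \<open>x\<close> lie outside the event on both sides.\<close>

lemma prob_trace_unqueried_cong: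
  assumes "\<And>y. y \<noteq> x \<Longrightarrow> \<sigma> y = \<sigma>' y"
  shows "measure_pmf.prob (trace w \<sigma> s) {(T, xs). x \<notin> set xs \<and> P T} =
         measure_pmf.prob (trace w \<sigma>' s) {(T, xs). x \<notin> set xs \<and> P T}"
proof -
  let ?B = "{(T, xs). x \<notin> set xs \<and> P T}"
  \<comment> \<open>With \<open>emeasure\<close> the case of a random choice compares nonnegative
    integrals, without integrability conditions.\<close>
  have "emeasure (trace w \<sigma> s) ?B = emeasure (trace w \<sigma>' s) ?B"
  proof (induction s)
    case (Strong y k)
    show ?case
    proof (cases "y = x")
      case True
      then have "(\<lambda>(T, xs). (T, y # xs)) -` ?B = {}" by auto
      then show ?thesis by (simp only: trace.simps emeasure_map_pmf emeasure_empty)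
    next
      case False
      then have "(\<lambda>(T, xs). (T, y # xs)) -` ?B = ?B" by auto
      then have lift: "emeasure (map_pmf (\<lambda>(T, xs). (T, y # xs)) M) ?B = emeasure M ?B" for M
        by (simp only: emeasure_map_pmf)
      show ?thesis
        unfolding trace.simps lift assms[OF False] using Strong by blast
    qed
  next
    case (Random p)
    then show ?case
      by (auto simp: bind_eq_join_pmf[symmetric] AE_measure_pmf_iff intro!: nn_integral_cong_AE)
  qed simp_all
  then show ?thesis by (simp add: measure_pmf.emeasure_eq_measure)
qed

section \<open>The law of the corrupted set\<close>

lemma sym_diff_cancel: "sym_diff (sym_diff A B) B = A"
  by blast

text \<open>Symmetric difference with a fixed \<open>S\<close> is an involution of
  \<open>Pow P\<close>. This is the change of variables between the corrupted set and the set seen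
  through the weak oracle.\<close>

lemma sum_Pow_sym_diff:
  assumes "S \<subseteq> P"
  shows "(\<Sum>E\<in>Pow P. f (sym_diff E S)) = (\<Sum>E\<in>Pow P. f E)"
proof (rule sum.reindex_bij_witness[where i = "\<lambda>E. sym_diff E S" and j = "\<lambda>E. sym_diff E S"])
  fix E assume "E \<in> Pow P"
  with assms show "sym_diff E S \<in> Pow P" by blast
qed (use assms in blast | simp only: sym_diff_cancel)+

lemma set_pmf_corrupted_pairs: "set_pmf (corrupted_pairs n \<delta>) \<subseteq> Pow (point_pairs n)"
  by (auto simp: corrupted_pairs_def)

lemma pmf_corrupted_pairs:
  assumes \<delta>: "0 \<le> \<delta>" "\<delta> \<le> 1" and C: "C \<subseteq> point_pairs n"
  shows "pmf (corrupted_pairs n \<delta>) C = \<delta> ^ card C * (1 - \<delta>) ^ (card (point_pairs n) - card C)"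
proof -
  let ?P = "point_pairs n" and ?h = "\<lambda>f. {e \<in> point_pairs n. f e}"
  let ?M = "Pi_pmf ?P False (\<lambda>_. bernoulli_pmf \<delta>)"
  let ?f = "\<lambda>e. e \<in> C"
  have "pmf (corrupted_pairs n \<delta>) C = measure ?M (?h -` {C})"
    by (simp add: corrupted_pairs_def pmf_def)
  \<comment> \<open>The preimage of \<open>C\<close> also contains functions that are true outside
    the point pairs; the default value \<open>False\<close> gives them mass 0.\<close>
  also have "\<dots> = measure ?M {?f}"
  proof (rule measure_pmf.finite_measure_eq_AE)
    have "f \<in> ?h -` {C} \<longleftrightarrow> f \<in> {?f}" if "f \<in> set_pmf ?M" for f
    proof -
      have "f e = False" if "e \<notin> ?P" for e
        using set_Pi_pmf_subset'[of ?P False "\<lambda>_. bernoulli_pmf \<delta>"] \<open>f \<in> set_pmf ?M\<close> that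
        by (auto simp: PiE_dflt_def)
      then show ?thesis using C by (auto simp: fun_eq_iff set_eq_iff)
    qed
    then show "AE f in ?M. f \<in> ?h -` {C} \<longleftrightarrow> f \<in> {?f}" by (simp add: AE_measure_pmf_iff)
  qed simp_all
  also have "\<dots> = pmf ?M ?f" by (simp add: pmf_def)
  also have "\<dots> = (\<Prod>e\<in>?P. pmf (bernoulli_pmf \<delta>) (e \<in> C))"
    using C by (intro pmf_Pi') auto
  also have "\<dots> = (\<Prod>e\<in>?P. if e \<in> C then \<delta> else 1 - \<delta>)"
    using \<delta> by (intro prod.cong) auto
  also have "\<dots> = \<delta> ^ card (?P \<inter> C) * (1 - \<delta>) ^ card (?P \<inter> - C)"
    by (subst prod.If_cases) auto
  also have "?P \<inter> C = C" using C by auto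
  also have "card (?P \<inter> - C) = card ?P - card C"
    using C by (simp add: Diff_eq[symmetric] card_Diff_subset finite_subset)
  finally show ?thesis .
qed

text \<open>With \<open>M\<close> pairs, a set \<open>B\<close> has mass
  \<open>2 ^ (M - card B) / 3 ^ M\<close>: each further corruption halves the mass, because 1/3 is
  half of 2/3.\<close>

lemma pmf_corrupted_pairs_ratio:
  assumes C: "C \<subseteq> point_pairs n" and C': "C' \<subseteq> point_pairs n" and u: "card C' \<le> card C + u"
  shows "pmf (corrupted_pairs n (1/3)) C \<le> 2 ^ u * pmf (corrupted_pairs n (1/3)) C'"
proof -
  let ?M = "card (point_pairs n)"
  have eq: "pmf (corrupted_pairs n (1/3)) B = 2 ^ (?M - card B) / 3 ^ ?M"
    if B: "B \<subseteq> point_pairs n" for B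
  proof -
    have "card B \<le> ?M" using B by (simp add: card_mono)
    then have "(3::real) ^ ?M = 3 ^ card B * 3 ^ (?M - card B)" by (simp add: power_add[symmetric])
    then show ?thesis using pmf_corrupted_pairs[of "1/3" B n] B by (simp add: power_divide)
  qed
  have "(2::real) ^ (?M - card C) \<le> 2 ^ (u + (?M - card C'))"
    using u by (intro power_increasing) auto
  then show ?thesis using C C' by (simp add: eq power_add divide_right_mono)
qed

section \<open>Runs on cluster instances and the effect of moving one point\<close>

definition cluster_trace ::
    "nat \<Rightarrow> real \<Rightarrow> (nat \<Rightarrow> nat) \<Rightarrow> strategy \<Rightarrow> (nat set set \<times> nat list) pmf" where
  "cluster_trace n D a s =
     bind_pmf (corrupted_pairs n (1/3)) (\<lambda>C.
       trace (two_valued n D (sym_diff C (cluster_pairs n a))) (cluster_symbol a) s)"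

lemma execution_flip:
  "execution n (1/3) (cluster_dist n D a) (flip_adversary n D a) (cluster_symbol a) s =
     map_pmf (map_prod id length) (cluster_trace n D a s)"
  unfolding execution_def cluster_trace_def map_bind_pmf
  using set_pmf_corrupted_pairs[of n "1/3"]
  by (intro bind_pmf_cong refl) (auto simp: weak_oracle_flip run_eq_trace)

lemma cluster_pairs_subset: "cluster_pairs n a \<subseteq> point_pairs n"
  by (auto simp: cluster_pairs_def)

text \<open>Summing over the observed set \<open>E\<close> instead of the corrupted set separates
  the two ways in which \<open>a\<close> enters: the likelihood of \<open>E\<close>, and the symbols
  returned by strong queries.\<close>

lemma prob_cluster_trace:
  "measure_pmf.prob (cluster_trace n D a s) B =
     (\<Sum>E\<in>Pow (point_pairs n). pmf (corrupted_pairs n (1/3)) (sym_diff E (cluster_pairs n a)) *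
        measure_pmf.prob (trace (two_valued n D E) (cluster_symbol a) s) B)"
proof -
  let ?S = "cluster_pairs n a" and ?P = "Pow (point_pairs n)"
  let ?p = "corrupted_pairs n (1/3)"
  let ?\<mu> = "\<lambda>E. measure_pmf.prob (trace (two_valued n D E) (cluster_symbol a) s) B"
  have "measure_pmf.prob (cluster_trace n D a s) B = (\<integral>C. ?\<mu> (sym_diff C ?S) \<partial>measure_pmf ?p)"
    unfolding cluster_trace_def measure_pmf_bind
    by (subst measure_pmf.measure_bind[where N = "count_space UNIV"])
       (auto simp: measurable_def space_subprob_algebra intro: measure_pmf.subprob_space_axioms)
  also have "\<dots> = (\<Sum>C\<in>?P. pmf ?p C * ?\<mu> (sym_diff C ?S))"
    using set_pmf_corrupted_pairs by (subst integral_measure_pmf[where A = ?P]) auto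
  also have "\<dots> = (\<Sum>E\<in>?P. pmf ?p (sym_diff E ?S) * ?\<mu> E)"
    using sum_Pow_sym_diff[OF cluster_pairs_subset[of n a],
      where f = "\<lambda>E. pmf ?p (sym_diff E ?S) * ?\<mu> E"]
    by (simp only: sym_diff_cancel)
  finally show ?thesis .
qed

lemma card_sym_diff_triangle:
  assumes "finite A" "finite B" "finite C"
  shows "card (sym_diff A C) \<le> card (sym_diff A B) + card (sym_diff B C)"
proof -
  have "card (sym_diff A C) \<le> card (sym_diff A B \<union> sym_diff B C)"
    using assms by (intro card_mono) auto
  also have "\<dots> \<le> card (sym_diff A B) + card (sym_diff B C)" by (rule card_Un_le)
  finally show ?thesis .
qed

lemma sum_pmf_sym_diff:
  assumes "S \<subseteq> point_pairs n"
  shows "(\<Sum>E\<in>Pow (point_pairs n). pmf (corrupted_pairs n \<delta>) (sym_diff E S)) = 1"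
  unfolding sum_Pow_sym_diff[OF assms] by (intro sum_pmf_eq_1 set_pmf_corrupted_pairs) simp

text \<open>No point has label \<open>N\<close> under \<open>a\<close>, so \<open>a(x := N)\<close>
  isolates \<open>x\<close>. The two clusterings differ only on pairs joining \<open>x\<close> to
  points labelled \<open>g\<close>, and so the corrupted sets that explain the same \<open>E\<close>
  differ in at most \<open>u\<close> pairs. The count may include \<open>x\<close> itself, which
  only weakens the bound.\<close>

lemma pmf_corrupted_pairs_move:
  assumes x: "x < n" and E: "E \<subseteq> point_pairs n" and N: "\<And>y. y < n \<Longrightarrow> a y < N"
    and u: "card {y \<in> {..<n}. a y = g} \<le> u"
  shows "pmf (corrupted_pairs n (1/3)) (sym_diff E (cluster_pairs n (a(x := g)))) \<le>
    2 ^ u * pmf (corrupted_pairs n (1/3)) (sym_diff E (cluster_pairs n (a(x := N))))"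
proof (rule pmf_corrupted_pairs_ratio)
  let ?G = "cluster_pairs n (a(x := g))" and ?N = "cluster_pairs n (a(x := N))"
  have fin: "finite E" "finite ?G" "finite ?N"
    using finite_subset[OF E] finite_subset[OF cluster_pairs_subset] by simp_all
  have "sym_diff ?G ?N \<subseteq> (\<lambda>y. {x, y}) ` {y \<in> {..<n}. a y = g}"
  proof
    fix e assume e: "e \<in> sym_diff ?G ?N"
    then have "e \<in> point_pairs n" by (auto simp: cluster_pairs_def)
    then obtain v w where vw: "e = {v, w}" "v < n" "w < n" "v \<noteq> w" by (rule point_pairs_cases)
    then have mem: "e \<in> cluster_pairs n b \<longleftrightarrow> b v = b w" for b by (auto simp: cluster_pairs_def)
    have "a v \<noteq> N" "a w \<noteq> N" using N[of v] N[of w] vw by auto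
    moreover have "(a(x := g)) v = (a(x := g)) w \<longleftrightarrow> (a(x := N)) v \<noteq> (a(x := N)) w"
      using e unfolding Un_iff Diff_iff mem by blast
    ultimately consider "v = x" "a w = g" | "w = x" "a v = g"
      using vw(4) by (auto split: if_splits)
    then show "e \<in> (\<lambda>y. {x, y}) ` {y \<in> {..<n}. a y = g}"
      using vw by cases (auto simp: insert_commute)
  qed
  then have "card (sym_diff ?G ?N) \<le> card {y \<in> {..<n}. a y = g}"
    by (intro surj_card_le) auto
  with u have "card (sym_diff ?G ?N) \<le> u" by simp
  with card_sym_diff_triangle[OF fin] show "card (sym_diff E ?N) \<le> card (sym_diff E ?G) + u"
    by linarith
qed (use E cluster_pairs_subset in blast)+

text \<open>The fibres are disjoint, and each large one has at least \<open>K + 1\<close>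
  points.\<close>

lemma card_large_fibres:
  assumes "finite G"
  shows "real (card {g \<in> G. card {y \<in> {..<n}. a y = g} > K}) \<le> real n / (real K + 1)"
proof -
  let ?u = "\<lambda>g. card {y \<in> {..<n::nat}. a y = g}" and ?H = "{g \<in> G. card {y \<in> {..<n}. a y = g} > K}"
  have "card ?H * (K + 1) = (\<Sum>g\<in>?H. K + 1)" by simp
  also have "\<dots> \<le> (\<Sum>g\<in>?H. ?u g)" by (intro sum_mono) auto
  also have "\<dots> = card (\<Union>g\<in>?H. {y \<in> {..<n}. a y = g})"
    using assms by (intro card_UN_disjoint[symmetric]) auto
  also have "\<dots> \<le> card {..<n}" by (intro card_mono) auto
  finally have "card ?H * (K + 1) \<le> n" by simp
  then have "real (card ?H) * (real K + 1) \<le> real n"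
    by (simp flip: of_nat_mult of_nat_Suc add: add.commute)
  then show ?thesis by (simp add: pos_le_divide_eq)
qed

text \<open>Placing \<open>x\<close> in the fresh cluster \<open>N\<close> instead of \<open>g\<close> changes the law of the weak answers by a
  factor of at most \<open>2\<close> per point of \<open>g\<close>. Under the fresh placement the answers, except for those to
  strong queries at \<open>x\<close>, do not depend on \<open>g\<close>, and the guesses for the different \<open>g\<close> exclude each
  other.\<close>

lemma unqueried_guess_bound:
  assumes x: "x < n" and a: "\<And>y. y < n \<Longrightarrow> a y < N"
  shows "(\<Sum>g<N. measure_pmf.prob (cluster_trace n D (a(x := g)) s)
            {(T, xs). x \<notin> set xs \<and> Q T \<and> a (p T) = g})
         \<le> 2 ^ K + real n / (real K + 1)"
proof -
  let ?B = "\<lambda>g. {(T, xs). x \<notin> set xs \<and> Q T \<and> a (p T) = g} :: (nat set set \<times> nat list) set"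
  let ?F = "\<lambda>g. measure_pmf.prob (cluster_trace n D (a(x := g)) s) (?B g)"
  \<comment> \<open>\<open>?H\<close> holds the clusters too large for the likelihood comparison;
    being few, they can afford the trivial bound 1 on each probability.\<close>
  let ?H = "{g \<in> {..<N}. card {y \<in> {..<n}. a y = g} > K}"
  let ?q = "\<lambda>b E. pmf (corrupted_pairs n (1/3)) (sym_diff E (cluster_pairs n b))"
  let ?\<nu> = "\<lambda>E g. measure_pmf.prob (trace (two_valued n D E) (cluster_symbol (a(x := N))) s) (?B g)"
  let ?P = "Pow (point_pairs n)"
  have small: "?F g \<le> 2 ^ K * (\<Sum>E\<in>?P. ?q (a(x := N)) E * ?\<nu> E g)" if "g \<in> {..<N} - ?H" for g
  proof -
    have "?F g = (\<Sum>E\<in>?P. ?q (a(x := g)) E * ?\<nu> E g)"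
      unfolding prob_cluster_trace
      by (intro sum.cong refl arg_cong2[where f = "(*)"] prob_trace_unqueried_cong)
         (simp add: cluster_symbol_def)
    also have "\<dots> \<le> (\<Sum>E\<in>?P. (2 ^ K * ?q (a(x := N)) E) * ?\<nu> E g)"
      using x a that by (intro sum_mono mult_right_mono pmf_corrupted_pairs_move) auto
    finally show ?thesis by (simp add: sum_distrib_left mult.assoc)
  qed
  have disj: "(\<Sum>g\<in>{..<N} - ?H. ?\<nu> E g) \<le> 1" for E
  proof -
    have "(\<Sum>g\<in>{..<N} - ?H. ?\<nu> E g) =
        measure_pmf.prob (trace (two_valued n D E) (cluster_symbol (a(x := N))) s)
          (\<Union>g\<in>{..<N} - ?H. ?B g)"
      by (intro measure_pmf.finite_measure_finite_Union[symmetric])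
         (auto simp: disjoint_family_on_def)
    also have "\<dots> \<le> 1" by simp
    finally show ?thesis .
  qed
  have "(\<Sum>g\<in>{..<N} - ?H. ?F g) \<le>
      (\<Sum>g\<in>{..<N} - ?H. 2 ^ K * (\<Sum>E\<in>?P. ?q (a(x := N)) E * ?\<nu> E g))"
    by (intro sum_mono small)
  also have "\<dots> = 2 ^ K * (\<Sum>E\<in>?P. ?q (a(x := N)) E * (\<Sum>g\<in>{..<N} - ?H. ?\<nu> E g))"
    unfolding sum_distrib_left[symmetric]
    by (subst sum.swap) (simp add: sum_distrib_left)
  also have "\<dots> \<le> 2 ^ K * (\<Sum>E\<in>?P. ?q (a(x := N)) E * 1)"
    by (intro mult_left_mono sum_mono disj) auto
  also have "\<dots> = 2 ^ K" by (simp add: sum_pmf_sym_diff cluster_pairs_subset)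
  finally have 1: "(\<Sum>g\<in>{..<N} - ?H. ?F g) \<le> 2 ^ K" .
  have "(\<Sum>g\<in>?H. ?F g) \<le> (\<Sum>g\<in>?H. 1)" by (intro sum_mono) simp
  also have "\<dots> \<le> real n / (real K + 1)" using card_large_fibres[where G = "{..<N}" and n = n and a = a and K = K] by simp
  finally have 2: "(\<Sum>g\<in>?H. ?F g) \<le> real n / (real K + 1)" .
  have "(\<Sum>g<N. ?F g) = (\<Sum>g\<in>{..<N} - ?H. ?F g) + (\<Sum>g\<in>?H. ?F g)"
    by (intro sum.subset_diff) auto
  with 1 2 show ?thesis by linarith
qed

section \<open>Averaging over all clusterings\<close>

text \<open>Resampling one coordinate of a uniformly random function preserves its law: exchanging
  \<open>g\<close> with the value at \<open>x\<close> is an involution on pairs of a function and a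
  value.\<close>

lemma sum_PiE_resample:
  fixes F :: "('a \<Rightarrow> 'b) \<Rightarrow> real"
  assumes x: "x \<in> I" and "finite G"
  shows "real (card G) * (\<Sum>a\<in>I \<rightarrow>\<^sub>E G. F a) = (\<Sum>a\<in>I \<rightarrow>\<^sub>E G. \<Sum>g\<in>G. F (a(x := g)))"
proof -
  have "(\<Sum>a\<in>I \<rightarrow>\<^sub>E G. \<Sum>g\<in>G. F (a(x := g))) =
      (\<Sum>(a, g)\<in>(I \<rightarrow>\<^sub>E G) \<times> G. F (a(x := g)))"
    by (simp add: sum.cartesian_product)
  also have "\<dots> = (\<Sum>(a, g)\<in>(I \<rightarrow>\<^sub>E G) \<times> G. F a)"
    using x
    by (intro sum.reindex_bij_witness[where i = "\<lambda>(a, g). (a(x := g), a x)"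
          and j = "\<lambda>(a, g). (a(x := g), a x)"])
       (auto simp: PiE_def extensional_def Pi_def)
  also have "\<dots> = (\<Sum>a\<in>I \<rightarrow>\<^sub>E G. \<Sum>g\<in>G. F a)"
    unfolding sum.cartesian_product ..
  finally show ?thesis by (simp add: sum_distrib_left)
qed

text \<open>Probabilistic method: for a fixed strategy and parent rule, resampling the label of
  \<open>x\<close> bounds the average over all clusterings for each \<open>x\<close>, so some
  clustering does no worse than the average of the sum.\<close>

lemma exists_hard_clustering:
  assumes N: "N > 0"
  shows "\<exists>a. (\<forall>y<n. a y < N) \<and>
    (\<Sum>x\<in>{0<..<n}. measure_pmf.prob (cluster_trace n D a s)
       {(T, xs). x \<notin> set xs \<and> p T x \<noteq> x \<and> p T x < n \<and> a (p T x) = a x})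
    \<le> real n * (2 ^ K + real n / (real K + 1)) / real N"
proof -
  let ?A = "{..<n} \<rightarrow>\<^sub>E {..<N}"
  let ?F = "\<lambda>x a. measure_pmf.prob (cluster_trace n D a s)
       {(T, xs). x \<notin> set xs \<and> p T x \<noteq> x \<and> p T x < n \<and> a (p T x) = a x}"
  define \<beta> where "\<beta> = 2 ^ K + real n / (real K + 1)"
  have \<beta>: "\<beta> \<ge> 0" by (simp add: \<beta>_def)
  have A: "finite ?A" "?A \<noteq> {}" using N by (auto simp: finite_PiE PiE_eq_empty_iff)
  have avg: "(\<Sum>a\<in>?A. ?F x a) \<le> real (card ?A) * (\<beta> / real N)" if x: "x \<in> {0<..<n}" for x
  proof -
    have "real (card {..<N}) * (\<Sum>a\<in>?A. ?F x a) = (\<Sum>a\<in>?A. \<Sum>g<N. ?F x (a(x := g)))"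
      by (rule sum_PiE_resample) (use x in auto)
    also have "\<dots> \<le> (\<Sum>a\<in>?A. \<beta>)"
    proof (intro sum_mono)
      fix a assume a: "a \<in> ?A"
      \<comment> \<open>Since \<open>p T x \<noteq> x\<close>, the label of the parent is unaffected
        by resampling at \<open>x\<close>, and the event is a guess of \<open>g\<close>.\<close>
      have "(\<Sum>g<N. ?F x (a(x := g))) = (\<Sum>g<N. measure_pmf.prob (cluster_trace n D (a(x := g)) s)
          {(T, xs). x \<notin> set xs \<and> (p T x \<noteq> x \<and> p T x < n) \<and> a (p T x) = g})"
        by (intro sum.cong refl arg_cong[where f = "measure_pmf.prob _"]) auto
      also have "\<dots> \<le> \<beta>"
        unfolding \<beta>_def using a x by (intro unqueried_guess_bound) auto
      finally show "(\<Sum>g<N. ?F x (a(x := g))) \<le> \<beta>" .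
    qed
    finally show ?thesis using N by (simp add: field_simps)
  qed
  show ?thesis
  proof (rule ccontr)
    assume none: "\<not> ?thesis"
    have "real (card ?A) * (real n * \<beta> / real N) = (\<Sum>a\<in>?A. real n * \<beta> / real N)" by simp
    also have "\<dots> < (\<Sum>a\<in>?A. \<Sum>x\<in>{0<..<n}. ?F x a)"
    proof (rule sum_strict_mono)
      fix a assume "a \<in> ?A"
      then have "\<forall>y<n. a y < N" by auto
      with none have "\<not> (\<Sum>x\<in>{0<..<n}. ?F x a) \<le> real n * \<beta> / real N"
        unfolding \<beta>_def by blast
      then show "real n * \<beta> / real N < (\<Sum>x\<in>{0<..<n}. ?F x a)" by (rule not_le_imp_less)
    qed (use A in auto)
    also have "\<dots> = (\<Sum>x\<in>{0<..<n}. \<Sum>a\<in>?A. ?F x a)" by (rule sum.swap)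
    also have "\<dots> \<le> (\<Sum>x\<in>{0<..<n}. real (card ?A) * (\<beta> / real N))" by (intro sum_mono avg)
    also have "\<dots> = real (n - 1) * (real (card ?A) * (\<beta> / real N))" by simp
    also have "\<dots> \<le> real n * (real (card ?A) * (\<beta> / real N))"
      using \<beta> by (intro mult_right_mono) auto
    finally show False by (simp add: algebra_simps)
  qed
qed

section \<open>Expected weight of the output tree\<close>

text \<open>Every point except \<open>0\<close> is strongly queried, or attached within its own
  cluster without being queried, or charged a parent edge of length \<open>D\<close>. Linearity of
  expectation turns this count into probabilities.\<close>

lemma expected_weight_ge:
  assumes D: "D \<ge> 1"
    and M: "\<And>T xs. (T, xs) \<in> set_pmf M \<Longrightarrow> spanning_tree n T \<and> length xs \<le> m"
    and p: "\<And>T. spanning_tree n T \<Longrightarrow>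
      (\<forall>x\<in>{0<..<n}. {x, p T x} \<in> T) \<and> inj_on (\<lambda>x. {x, p T x}) {0<..<n}"
  shows "D * (real n - 1 - real m - (\<Sum>x\<in>{0<..<n}. measure_pmf.prob M
       {(T, xs). x \<notin> set xs \<and> p T x \<noteq> x \<and> p T x < n \<and> a (p T x) = a x}))
    \<le> measure_pmf.expectation M (\<lambda>(T, xs). tree_weight (cluster_dist n D a) T)"
proof -
  let ?d = "cluster_dist n D a"
  define B :: "nat \<Rightarrow> (nat set set \<times> nat list) set" where
    "B x = {(T, xs). x \<notin> set xs \<and> p T x \<noteq> x \<and> p T x < n \<and> a (p T x) = a x}" for x
  let ?L = "\<lambda>z. D * (real n - 1 - real m - (\<Sum>x\<in>{0<..<n}. indicator (B x) z))"
  let ?w = "\<lambda>(T, xs :: nat list). tree_weight ?d T"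
  have pointwise: "?L (T, xs) \<le> tree_weight ?d T" if z: "(T, xs) \<in> set_pmf M" for T xs
  proof -
    have T: "spanning_tree n T" and len: "length xs \<le> m" using M[OF z] by auto
    then have sub: "T \<subseteq> point_pairs n" by (simp add: spanning_tree_def)
    have pT: "{x, p T x} \<in> T" "p T x \<noteq> x" "p T x < n" if "x \<in> {0<..<n}" for x
    proof -
      show "{x, p T x} \<in> T" using p[OF T] that by blast
      with sub have "{x, p T x} \<in> point_pairs n" by blast
      then show "p T x \<noteq> x" "p T x < n" by auto
    qed
    define S where "S = {x \<in> {0<..<n}. a (p T x) \<noteq> a x}"
    have "D * real (card S) \<le> tree_weight ?d T"
    proof (rule tree_weight_ge[OF sub])
      show "inj_on (\<lambda>x. {x, p T x}) S"
        using p[OF T] by (auto simp: S_def intro: inj_on_subset)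
    next
      fix x assume "x \<in> S"
      then show "{x, p T x} \<in> T" "D \<le> ?d x (p T x)"
        using pT[of x] by (auto simp: S_def cluster_dist_eq)
    qed (use D in \<open>auto simp: S_def cluster_dist_eq\<close>)
    moreover have "real n - 1 - real m - (\<Sum>x\<in>{0<..<n}. indicator (B x) (T, xs)) \<le> real (card S)"
    proof -
      let ?U = "{x \<in> {0<..<n}. (T, xs) \<in> B x}"
      have "card {0<..<n} \<le> card (S \<union> set xs \<union> ?U)"
        using pT by (intro card_mono) (auto simp: S_def B_def)
      also have "\<dots> \<le> card S + card (set xs) + card ?U"
        by (meson card_Un_le le_trans add_le_mono le_refl)
      also have "card (set xs) \<le> m" using card_length[of xs] len by linarith
      finally have "n - 1 \<le> card S + m + card ?U" by simp
      moreover have "(\<Sum>x\<in>{0<..<n}. indicator (B x) (T, xs)) = real (card ?U)"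
      proof -
        have "{0<..<n} \<inter> {x. (T, xs) \<in> B x} = ?U" by auto
        then show ?thesis by (simp add: indicator_def sum.If_cases)
      qed
      ultimately show ?thesis by linarith
    qed
    ultimately show ?thesis using D by (meson mult_left_mono order_trans zero_le_one)
  qed
  have "integrable M ?w"
  proof (rule measure_pmf.integrable_const_bound)
    \<comment> \<open>Output trees are subsets of the finite set of pairs, so the weight is bounded
      on the support of \<open>M\<close>.\<close>
    let ?W = "(\<lambda>T. \<bar>tree_weight ?d T\<bar>) ` Pow (point_pairs n)"
    have "norm (?w z) \<le> Max ?W" if "z \<in> set_pmf M" for z
      using M[of "fst z" "snd z"] that
      by (intro Max_ge) (auto simp: case_prod_beta spanning_tree_def)
    then show "AE z in M. norm (?w z) \<le> Max ?W" by (simp add: AE_measure_pmf_iff)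
  qed simp
  moreover have int: "integrable M (indicator (B x) :: _ \<Rightarrow> real)" for x
    by (rule measure_pmf.integrable_const_bound[where B = 1]) (auto simp: indicator_def)
  ultimately have "measure_pmf.expectation M ?L \<le> measure_pmf.expectation M ?w"
    using pointwise by (intro integral_mono_AE) (auto simp: AE_measure_pmf_iff)
  also have "measure_pmf.expectation M ?L =
      D * (real n - 1 - real m - (\<Sum>x\<in>{0<..<n}. measure_pmf.prob M (B x)))"
    using int by simp
  finally show ?thesis by (simp add: B_def)
qed

section \<open>Choice of parameters and the final contradiction\<close>

theorem theorem6p3:
  shows "\<exists>c>0::real. \<exists>b>0::real. \<exists>n0::nat. \<forall>n\<ge>n0. \<forall>(A::algorithm) (m::nat).
    outputs_spanning_tree n (1/3) A \<longrightarrow>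
    expected_mst_approx n (1/3) (c * ln (real n)) A \<longrightarrow>
    strong_queries_at_most n (1/3) m A \<longrightarrow>
    real m \<ge> b * real n"
proof -
  \<comment> \<open>The second condition makes \<open>2 ^ K\<close> at most of order
    \<open>n / ln n\<close>, as \<open>2 powr (ln n / 2)\<close> is a power of \<open>n\<close> with
    exponent below 1/2. The third is the exact negation of what the final estimate leaves
    over.\<close>
  have "eventually (\<lambda>n::nat. n > 1 \<and> 2 powr (ln (real n) / 2) * ln (real n) \<le> real n \<and>
      1 + ln (real n) / 32 < 3 * real n / 8) sequentially"
    by (intro eventually_conj; real_asymp)
  then obtain n0 where n0: "\<And>n. n \<ge> n0 \<Longrightarrow> n > 1 \<and>
      2 powr (ln (real n) / 2) * ln (real n) \<le> real n \<and> 1 + ln (real n) / 32 < 3 * real n / 8"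
    by (auto simp: eventually_sequentially)
  have "real m \<ge> 1/8 * real n"
    if n: "n \<ge> n0" and tree: "outputs_spanning_tree n (1/3) A"
      and approx: "expected_mst_approx n (1/3) (1/64 * ln (real n)) A"
      and queries: "strong_queries_at_most n (1/3) m A" for n m and A :: algorithm
  proof (rule ccontr)
    assume m: "\<not> real m \<ge> 1/8 * real n"
    define L where "L = ln (real n)"
    \<comment> \<open>With \<open>D = n\<close> all unit edges together cost about one long edge.
      \<open>N\<close> makes the permitted weight about \<open>D * n / 8\<close>, and
      \<open>K\<close> makes the large clusters at most about a quarter of all
      \<open>N\<close>.\<close>
    define D where "D = real n"
    define N where "N = nat \<lceil>8 * real n / L\<rceil>"
    define K where "K = nat \<lfloor>L / 2\<rfloor>"
    have n1: "n > 1" and asym: "2 powr (L / 2) * L \<le> real n" "1 + L / 32 < 3 * real n / 8"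
      using n0[OF n] by (auto simp: L_def)
    have L: "L > 0" using n1 by (simp add: L_def)
    have N: "8 * real n / L \<le> real N" "real N \<le> 8 * real n / L + 1" "N > 0"
      using L n1 by (auto simp: N_def)
    have K: "real K \<le> L / 2" "L / 2 \<le> real K + 1"
      using L of_int_floor_le[of "L / 2"] real_of_int_floor_add_one_ge[of "L / 2"]
      by (simp_all add: K_def)
    have D: "D \<ge> 1" using n1 by (simp add: D_def)
    \<comment> \<open>The decoder depends on \<open>D\<close> alone, so the strategy is fixed before
      the clustering is chosen; the same holds for the parent rule \<open>p\<close> below.\<close>
    let ?s = "A (cluster_decode D)"
    have "\<forall>T. \<exists>p. spanning_tree n T \<longrightarrow>
        (\<forall>x\<in>{0<..<n}. {x, p x} \<in> T) \<and> inj_on (\<lambda>x. {x, p x}) {0<..<n}"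
      using connected_parent n1 by (auto simp: spanning_tree_def)
    then obtain p where p: "\<And>T. spanning_tree n T \<Longrightarrow>
        (\<forall>x\<in>{0<..<n}. {x, p T x} \<in> T) \<and> inj_on (\<lambda>x. {x, p T x}) {0<..<n}"
      by metis
    obtain a where a: "\<And>y. y < n \<Longrightarrow> a y < N" and
      guess: "(\<Sum>x\<in>{0<..<n}. measure_pmf.prob (cluster_trace n D a ?s)
          {(T, xs). x \<notin> set xs \<and> p T x \<noteq> x \<and> p T x < n \<and> a (p T x) = a x})
        \<le> real n * (2 ^ K + real n / (real K + 1)) / real N" (is "?G \<le> _")
      using exists_hard_clustering[OF N(3), of n D ?s p K] by auto
    let ?ex = "execution n (1/3) (cluster_dist n D a) (flip_adversary n D a) (cluster_symbol a) ?s"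
    have inst: "weak_strong_instance n (cluster_dist n D a) (cluster_symbol a) (cluster_decode D)"
      using D by (rule weak_strong_instance_cluster)
    have out: "spanning_tree n T \<and> length xs \<le> m" if "(T, xs) \<in> set_pmf (cluster_trace n D a ?s)" for T xs
    proof -
      have "(T, length xs) \<in> set_pmf ?ex" using that by (force simp: execution_flip)
      then show ?thesis using tree queries inst
        unfolding outputs_spanning_tree_def strong_queries_at_most_def by fast
    qed
    have "D * (real n - 1 - real m - ?G) \<le>
        measure_pmf.expectation (cluster_trace n D a ?s) (\<lambda>(T, xs). tree_weight (cluster_dist n D a) T)"
      using D out p by (rule expected_weight_ge)
    also have "\<dots> = measure_pmf.expectation ?ex (\<lambda>(T, q). tree_weight (cluster_dist n D a) T)"
      by (simp add: execution_flip case_prod_unfold)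
    also have "\<dots> \<le> 1/64 * L * mst_weight n (cluster_dist n D a)"
      using approx inst unfolding expected_mst_approx_def L_def by blast
    also have "\<dots> \<le> 1/64 * L * (real n + D * real N)"
      using L D n1 a by (intro mult_left_mono mst_weight_cluster_le) auto
    also have "\<dots> = D * (1/64 * L * (1 + real N))" by (simp add: D_def algebra_simps)
    finally have "real n - 1 - real m - ?G \<le> 1/64 * L * (1 + real N)" using D by simp
    also have "\<dots> \<le> 1/64 * L * (1 + (8 * real n / L + 1))"
      using L N by (intro mult_left_mono) auto
    also have "\<dots> = L / 32 + real n / 8" using L by (simp add: field_simps)
    finally have main: "real n - 1 - real m - ?G \<le> L / 32 + real n / 8" .
    have "?G \<le> real n * (2 ^ K + real n / (real K + 1)) / real N" by (rule guess)
    also have "\<dots> \<le> real n * (2 powr (L / 2) + real n / (L / 2)) / (8 * real n / L)"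
    proof (intro frac_le mult_left_mono add_mono)
      show "(2::real) ^ K \<le> 2 powr (L / 2)" using K by (simp add: powr_realpow[symmetric])
    qed (use L K N n1 in auto)
    also have "\<dots> = 2 powr (L / 2) * L / 8 + real n / 4" using L n1 by (simp add: field_simps)
    also have "\<dots> \<le> real n / 8 + real n / 4" using asym by simp
    \<comment> \<open>Fewer than \<open>n / 8\<close> queried points and at most
      \<open>3 * n / 8\<close> expected correct guesses would leave
      \<open>3 * n / 8 < 1 + L / 32\<close>.\<close>
    finally show False using main m asym by simp
  qed
  then show ?thesis
    by (intro exI[of _ "1/64"] exI[of _ "1/8"] exI[of _ n0] conjI allI impI) simp_all
qed

end
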